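(* Let $G$ be a unicyclic graph on $n\geq 5$ vertices that contains $C_4$ as an induced subgraph (so its unique cycle is this $4$-cycle). Consider the degrees in $G$ of the four vertices of this cycle. Then: (1) if at most one vertex of the cycle has degree $2$, then $\operatorname{Z}(\overline{G})=n-4$; (2) if exactly two vertices of the cycle have degree $2$, then (a) if these two vertices are adjacent, $\operatorname{Z}(\overline{G})=n-4$, and (b) if these two vertices are not adjacent, $\operatorname{Z}(\overline{G})=n-3$; (3) if exactly three vertices of the cycle have degree $2$, then $\operatorname{Z}(\overline{G})=n-3$.
   Context: All graphs are finite, simple and undirected. A unicyclic graph is a connected graph containing exactly one cycle. $\overline{G}$ denotes the complement of $G$ (same vertex set; distinct vertices adjacent iff not adjacent in $G$). Zero forcing: given an initial set $B\subseteq V(G)$ of blue vertices (all others white), a blue vertex with exactly one white neighbor may turn that neighbor blue; $B$ is a zero forcing set if repeated application makes all vertices blue. $\operatorname{Z}(G)$ is the minimum size of a zero forcing set of $G$. *)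

theory Defs
  imports Main
begin

type_synonym 'a graph = "'a set \<times> 'a set set"

abbreviation verts :: "'a graph \<Rightarrow> 'a set" where
  "verts G \<equiv> fst G"

abbreviation edges :: "'a graph \<Rightarrow> 'a set set" where
  "edges G \<equiv> snd G"

definition simple_graph :: "'a graph \<Rightarrow> bool" where
  "simple_graph G \<longleftrightarrow> finite (verts G) \<and> edges G \<subseteq> {e. e \<subseteq> verts G \<and> card e = 2}"

definition adj :: "'a graph \<Rightarrow> 'a \<Rightarrow> 'a \<Rightarrow> bool" where
  "adj G u v \<longleftrightarrow> {u, v} \<in> edges G"

definition neighbors :: "'a graph \<Rightarrow> 'a \<Rightarrow> 'a set" where
  "neighbors G u = {v \<in> verts G. adj G u v}"

definition degree :: "'a graph \<Rightarrow> 'a \<Rightarrow> nat" where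
  "degree G u = card (neighbors G u)"

definition complement :: "'a graph \<Rightarrow> 'a graph" where
  "complement G = (verts G, {{u, v} | u v. u \<in> verts G \<and> v \<in> verts G \<and> u \<noteq> v \<and> \<not> adj G u v})"

definition subgraph :: "'a graph \<Rightarrow> 'a graph \<Rightarrow> bool" where
  "subgraph H G \<longleftrightarrow> verts H \<subseteq> verts G \<and> edges H \<subseteq> edges G"

definition induced_subgraph :: "'a graph \<Rightarrow> 'a set \<Rightarrow> 'a graph" where
  "induced_subgraph G S = (S, {e \<in> edges G. e \<subseteq> S})"

definition connected_graph :: "'a graph \<Rightarrow> bool" where
  "connected_graph G \<longleftrightarrow> verts G \<noteq> {} \<and> (\<forall>u\<in>verts G. \<forall>v\<in>verts G. (adj G)\<^sup>*\<^sup>* u v)"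

text \<open>A cycle is a graph, not a vertex sequence, so that rotating or reversing the
  sequence \<open>vs\<close> of its vertices yields the same cycle.\<close>

definition cycle_graph :: "nat \<Rightarrow> 'a graph \<Rightarrow> bool" where
  "cycle_graph k C \<longleftrightarrow> 3 \<le> k \<and> (\<exists>vs. length vs = k \<and> distinct vs \<and>
     C = (set vs, {{vs ! i, vs ! ((i + 1) mod k)} | i. i < k}))"

definition unicyclic :: "'a graph \<Rightarrow> bool" where
  "unicyclic G \<longleftrightarrow> connected_graph G \<and> (\<exists>!C. subgraph C G \<and> (\<exists>k. cycle_graph k C))"

inductive force_step :: "'a graph \<Rightarrow> 'a set \<Rightarrow> 'a set \<Rightarrow> bool" for G where
  "u \<in> B \<Longrightarrow> neighbors G u - B = {w} \<Longrightarrow> force_step G B (insert w B)"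

definition zero_forcing_set :: "'a graph \<Rightarrow> 'a set \<Rightarrow> bool" where
  "zero_forcing_set G B \<longleftrightarrow> B \<subseteq> verts G \<and> (force_step G)\<^sup>*\<^sup>* B (verts G)"

definition zero_forcing_number :: "'a graph \<Rightarrow> nat" where
  "zero_forcing_number G = Min {card B | B. zero_forcing_set G B}"

end

theory Submission
  imports Defs
begin

text \<open>Writing \<open>W\<close> for the white set, a blue vertex \<open>u\<close> forces \<open>w\<close> in the complement of \<open>G\<close> iff
  \<open>u\<close> is adjacent in \<open>G\<close> to every vertex of \<open>W - {w}\<close> but not to \<open>w\<close>. Five white vertices would
  thus give two forcing vertices with three common neighbours in \<open>G\<close>, hence two different
  4-cycles. Four white vertices \<open>w\<^sub>1, \<dots>, w\<^sub>4\<close> forced in this order by \<open>u\<^sub>1, \<dots>, u\<^sub>4\<close> make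
  \<open>u\<^sub>1 w\<^sub>3 u\<^sub>2 w\<^sub>4\<close> the cycle, and \<open>u\<^sub>1\<close>, \<open>w\<^sub>4\<close> have the further neighbours \<open>w\<^sub>2\<close>, \<open>u\<^sub>3\<close>.
  Conversely, two adjacent cycle vertices of degree at least 3 give such a forcing sequence, and
  a single one gives a sequence of length three.\<close>

section \<open>Forcing in the complement, in terms of the white set\<close>

lemma adj_commute: "adj G u v \<longleftrightarrow> adj G v u"
  by (simp add: adj_def insert_commute)

lemma adj_imp_verts:
  assumes "simple_graph G" "adj G u v"
  shows "u \<in> verts G" "v \<in> verts G" "u \<noteq> v"
  using assms by (auto simp: simple_graph_def adj_def)

lemma verts_complement [simp]: "verts (complement G) = verts G"
  by (simp add: complement_def)

lemma neighbors_complement: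
  assumes "u \<in> verts G"
  shows "neighbors (complement G) u = {v \<in> verts G. v \<noteq> u \<and> \<not> adj G u v}"
  using assms adj_commute[of G]
  by (auto simp: neighbors_def adj_def complement_def doubleton_eq_iff insert_commute)

text \<open>Prepends one force: \<open>w\<close> is the only complement neighbour of
  \<open>u\<close> that is white, and after it turns blue exactly \<open>W\<close> is white. Forcing
  sequences are therefore built backwards, from the last force to the first.\<close>

lemma zero_forcing_complement_step:
  assumes "zero_forcing_set (complement G) (verts G - W)"
    and "u \<in> verts G" "u \<notin> W" "u \<noteq> w" "w \<in> verts G" "w \<notin> W"
    and "\<not> adj G u w" "\<forall>x\<in>W. adj G u x"
  shows "zero_forcing_set (complement G) (verts G - insert w W)"
proof -
  let ?B = "verts G - insert w W"
  have "neighbors (complement G) u - ?B = {w}"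
    using assms by (auto simp: neighbors_complement)
  moreover have "u \<in> ?B" using assms by auto
  ultimately have "force_step (complement G) ?B (insert w ?B)"
    by (intro force_step.intros)
  moreover have "insert w ?B = verts G - W" using assms by auto
  ultimately show ?thesis
    using assms(1) by (auto simp: zero_forcing_set_def intro: converse_rtranclp_into_rtranclp)
qed

text \<open>The converse reading: a nonempty white set means that the forcing sequence is nonempty,
  and its first force is peeled off. \<open>W'\<close> is the set still white afterwards.\<close>

lemma zero_forcing_complement_stepE:
  assumes "zero_forcing_set (complement G) (verts G - W)" "W \<subseteq> verts G" "card W = Suc k"
  obtains u w W' where "W = insert w W'" "w \<notin> W'" "card W' = k" "W' \<subseteq> verts G"
    "u \<in> verts G" "u \<notin> W" "\<not> adj G u w" "\<forall>x\<in>W'. adj G u x"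
    "zero_forcing_set (complement G) (verts G - W')"
proof -
  let ?B = "verts G - W"
  have fin: "finite W" using assms(3) card.infinite by fastforce
  have "W \<noteq> {}" using assms(3) by auto
  then have ne: "?B \<noteq> verts G" using assms(2) by blast
  have "(force_step (complement G))\<^sup>*\<^sup>* ?B (verts G)"
    using assms(1) by (simp add: zero_forcing_set_def)
  then obtain B' where st: "force_step (complement G) ?B B'"
    and rest: "(force_step (complement G))\<^sup>*\<^sup>* B' (verts G)"
    using ne by (metis converse_rtranclpE)
  from st obtain u w where u: "u \<in> ?B"
    and w: "neighbors (complement G) u - ?B = {w}" and B': "B' = insert w ?B"
    by (auto elim: force_step.cases)
  have w': "{v \<in> verts G. v \<noteq> u \<and> \<not> adj G u v} - ?B = {w}"
    using u w by (simp add: neighbors_complement)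
  then have wW: "w \<in> W" "\<not> adj G u w" by auto
  \<comment> \<open>A second white vertex not adjacent to \<open>u\<close> in \<open>G\<close> would
    be a second white neighbour in the complement.\<close>
  have others: "adj G u x" if "x \<in> W - {w}" for x
    using w' that u assms(2) by blast
  have B'eq: "B' = verts G - (W - {w})" using B' wW assms(2) by auto
  show thesis
    by (rule that[of w "W - {w}" u])
      (use wW others u rest assms fin B'eq in \<open>auto simp: zero_forcing_set_def\<close>)
qed

text \<open>Each force removes one white vertex and leaves a zero forcing set, so the number of
  white vertices passes through every smaller value.\<close>

lemma zero_forcing_set_few_white:
  assumes "finite (verts G)" "zero_forcing_set (complement G) B" "k \<le> card (verts G - B)"
  obtains W where "W \<subseteq> verts G" "card W = k" "zero_forcing_set (complement G) (verts G - W)"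
proof -
  have "\<exists>W \<subseteq> verts G. card W = k \<and> zero_forcing_set (complement G) (verts G - W)"
    if "W \<subseteq> verts G" "card W = k + m" "zero_forcing_set (complement G) (verts G - W)" for W m
    using that
  proof (induction m arbitrary: W)
    case 0
    then show ?case by auto
  next
    case (Suc m)
    then have "card W = Suc (k + m)" by simp
    from zero_forcing_complement_stepE[OF Suc.prems(3,1) this] Suc.IH show ?case
      by metis
  qed
  moreover have "verts G - (verts G - B) = B"
    using assms(2) by (auto simp: zero_forcing_set_def)
  moreover obtain m where "card (verts G - B) = k + m"
    using assms(3) le_Suc_ex by blast
  ultimately show thesis
    using that assms(2) by (metis Diff_subset)
qed

text \<open>By the preceding descent it suffices to exclude white sets of size exactly
  \<open>Suc k\<close>; all larger ones are then excluded too.\<close>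

lemma zero_forcing_number_complement_eqI:
  assumes "finite (verts G)" "W \<subseteq> verts G" "card W = k"
    and "zero_forcing_set (complement G) (verts G - W)"
    and max: "\<And>W. W \<subseteq> verts G \<Longrightarrow> card W = Suc k \<Longrightarrow>
      \<not> zero_forcing_set (complement G) (verts G - W)"
  shows "zero_forcing_number (complement G) = card (verts G) - k"
  unfolding zero_forcing_number_def
proof (rule Min_eqI)
  have "{card B |B. zero_forcing_set (complement G) B} \<subseteq> card ` Pow (verts G)"
    by (auto simp: zero_forcing_set_def)
  then show "finite {card B |B. zero_forcing_set (complement G) B}"
    using assms(1) finite_subset by blast
next
  have "card (verts G - W) = card (verts G) - k"
    using assms by (simp add: card_Diff_subset finite_subset)
  then show "card (verts G) - k \<in> {card B |B. zero_forcing_set (complement G) B}"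
    using assms(4) by (metis (mono_tags, lifting) mem_Collect_eq)
next
  fix y assume "y \<in> {card B |B. zero_forcing_set (complement G) B}"
  then obtain B where B: "zero_forcing_set (complement G) B" and y: "y = card B" by auto
  have "\<not> Suc k \<le> card (verts G - B)"
    using zero_forcing_set_few_white[OF assms(1) B] max by metis
  moreover have "B \<subseteq> verts G" using B by (simp add: zero_forcing_set_def)
  ultimately show "card (verts G) - k \<le> y"
    using assms(1) y by (simp add: card_Diff_subset finite_subset)
qed

section \<open>4-cycles and degrees of their vertices\<close>

lemma cycle_graph_4_iff:
  "cycle_graph 4 C \<longleftrightarrow>
    (\<exists>a b c d. distinct [a, b, c, d] \<and> C = ({a, b, c, d}, {{a, b}, {b, c}, {c, d}, {d, a}}))"
proof -
  have E: "{{vs ! i, vs ! ((i + 1) mod 4)} |i. i < 4} = {{a, b}, {b, c}, {c, d}, {d, a}}"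
    if "vs = [a, b, c, d]" for vs and a b c d :: 'a
  proof -
    have "{i. i < (4::nat)} = {0, 1, 2, 3}" by auto
    then show ?thesis using that by (simp add: setcompr_eq_image)
  qed
  have L: "length vs = 4 \<longleftrightarrow> (\<exists>a b c d. vs = [a, b, c, d])" for vs :: "'a list"
    by (auto simp: numeral_eq_Suc length_Suc_conv)
  show ?thesis
  proof
    assume "cycle_graph 4 C"
    then obtain vs where "length vs = 4" "distinct vs"
      and C: "C = (set vs, {{vs ! i, vs ! ((i + 1) mod 4)} |i. i < 4})"
      by (auto simp: cycle_graph_def)
    moreover obtain a b c d where vs: "vs = [a, b, c, d]" using \<open>length vs = 4\<close> L by auto
    ultimately have "distinct [a, b, c, d]"
      "C = ({a, b, c, d}, {{a, b}, {b, c}, {c, d}, {d, a}})"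
      using E[OF vs] by simp_all
    then show "\<exists>a b c d. distinct [a, b, c, d] \<and>
        C = ({a, b, c, d}, {{a, b}, {b, c}, {c, d}, {d, a}})"
      by blast
  next
    assume "\<exists>a b c d. distinct [a, b, c, d] \<and>
        C = ({a, b, c, d}, {{a, b}, {b, c}, {c, d}, {d, a}})"
    then obtain a b c d where "distinct [a, b, c, d]"
      "C = ({a, b, c, d}, {{a, b}, {b, c}, {c, d}, {d, a}})" by blast
    then show "cycle_graph 4 C"
      unfolding cycle_graph_def using E[OF refl, of a b c d]
      by (intro conjI exI[of _ "[a, b, c, d]"]) simp_all
  qed
qed

text \<open>A labelled 4-cycle, possibly with chords. Rotations and reflections are further
  labellings of the same cycle, so a claim about \<open>a\<close> and \<open>b\<close> for all
  labellings covers every pair of consecutive vertices.\<close>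

definition four_cycle :: "'a graph \<Rightarrow> 'a \<Rightarrow> 'a \<Rightarrow> 'a \<Rightarrow> 'a \<Rightarrow> bool" where
  "four_cycle G a b c d \<longleftrightarrow>
    distinct [a, b, c, d] \<and> adj G a b \<and> adj G b c \<and> adj G c d \<and> adj G d a"

lemma four_cycle_rotate: "four_cycle G a b c d \<Longrightarrow> four_cycle G b c d a"
  by (auto simp: four_cycle_def)

lemma unicyclic_four_cycle:
  assumes "simple_graph G" "unicyclic G" "S \<subseteq> verts G" "cycle_graph 4 (induced_subgraph G S)"
    and "four_cycle G p q r s"
  shows "{p, q, r, s} = S"
proof -
  let ?C = "({p, q, r, s}, {{p, q}, {q, r}, {r, s}, {s, p}})"
  have "cycle_graph 4 ?C"
    using assms(5) by (auto simp: cycle_graph_4_iff four_cycle_def)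
  moreover have "subgraph ?C G"
    using assms(1,5) adj_imp_verts[OF assms(1)]
    by (auto simp: subgraph_def four_cycle_def adj_def)
  moreover have "subgraph (induced_subgraph G S) G"
    using assms(3) by (auto simp: subgraph_def induced_subgraph_def)
  ultimately have "?C = induced_subgraph G S"
    using assms(2,4) unfolding unicyclic_def by metis
  then show ?thesis by (simp add: induced_subgraph_def)
qed

text \<open>A cycle vertex has two neighbours on the cycle, so for it
  \<open>degree G v \<noteq> 2\<close> amounts to degree at least 3.\<close>

lemma third_neighborE:
  assumes "simple_graph G" "degree G v \<noteq> 2" "adj G v p" "adj G v q" "p \<noteq> q"
  obtains x where "adj G v x" "x \<noteq> p" "x \<noteq> q"
proof -
  have "\<not> neighbors G v \<subseteq> {p, q}"
  proof
    assume "neighbors G v \<subseteq> {p, q}"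
    then have "neighbors G v = {p, q}"
      using assms adj_imp_verts[OF assms(1)] by (auto simp: neighbors_def)
    then show False using assms by (simp add: degree_def)
  qed
  then show thesis using that by (auto simp: neighbors_def)
qed

lemma degree_neq_2_if_three_neighbors:
  assumes "simple_graph G" "adj G v p" "adj G v q" "adj G v r" "distinct [p, q, r]"
  shows "degree G v \<noteq> 2"
proof -
  have "{p, q, r} \<subseteq> neighbors G v"
    using assms adj_imp_verts[OF assms(1)] by (auto simp: neighbors_def)
  moreover have "finite (neighbors G v)"
    using assms(1) by (auto simp: simple_graph_def neighbors_def)
  ultimately have "card {p, q, r} \<le> degree G v" unfolding degree_def by (rule card_mono[rotated])
  then show ?thesis using assms(5) by simp
qed

section \<open>Forcing when the 4-cycle is unique and chordless\<close>

text \<open>These are the consequences of the hypotheses on which the forcing arguments rest. The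
  second diagonal is obtained by rotating the labels.\<close>

locale unique_four_cycle =
  fixes G :: "'a graph" and S :: "'a set"
  assumes simple: "simple_graph G"
    and unique: "four_cycle G p q r s \<Longrightarrow> {p, q, r, s} = S"
    and diagonal_not_adj: "four_cycle G p q r s \<Longrightarrow> \<not> adj G p r"
begin

lemma no_zero_forcing_5_white:
  assumes "W \<subseteq> verts G" "card W = 5"
  shows "\<not> zero_forcing_set (complement G) (verts G - W)"
proof
  assume zf: "zero_forcing_set (complement G) (verts G - W)"
  have "card W = Suc 4" using assms(2) by simp
  from zero_forcing_complement_stepE[OF zf assms(1) this]
  obtain u1 w1 W4 where 1: "W = insert w1 W4" "card W4 = 4" "W4 \<subseteq> verts G" "u1 \<notin> W"
    "\<forall>x\<in>W4. adj G u1 x" and zf4: "zero_forcing_set (complement G) (verts G - W4)"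
    by metis
  have "card W4 = Suc 3" using 1 by simp
  from zero_forcing_complement_stepE[OF zf4 1(3) this]
  obtain u2 w2 W3 where 2: "W4 = insert w2 W3" "card W3 = 3" "u2 \<notin> W4"
    "\<not> adj G u2 w2" "\<forall>x\<in>W3. adj G u2 x"
    by metis
  obtain x y z where W3: "W3 = {x, y, z}" "x \<noteq> y" "x \<noteq> z" "y \<noteq> z"
    using 2(2) by (auto simp: card_3_iff)
  \<comment> \<open>\<open>u1\<close> is adjacent to \<open>w2\<close>, while \<open>u2\<close> is
    not.\<close>
  have "u1 \<noteq> u2" using 1 2 by auto
  then have "four_cycle G u1 x u2 y" "four_cycle G u1 x u2 z"
    using 1 2 W3 by (auto simp: four_cycle_def adj_commute)
  \<comment> \<open>Equality would put \<open>z\<close> into \<open>{u1, x, u2, y}\<close>, but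
    \<open>u1\<close> and \<open>u2\<close> lie outside \<open>W3\<close>.\<close>
  then have "{u1, x, u2, y} = {u1, x, u2, z}" using unique by metis
  then show False using W3 1 2 by auto
qed

lemma zero_forcing_4_white_imp_adj:
  assumes "W \<subseteq> verts G" "card W = 4" "zero_forcing_set (complement G) (verts G - W)"
  obtains a b c d where "four_cycle G a b c d" "degree G a \<noteq> 2" "degree G b \<noteq> 2"
proof -
  have "card W = Suc 3" using assms(2) by simp
  from zero_forcing_complement_stepE[OF assms(3,1) this]
  obtain u1 w1 W3 where 1: "W = insert w1 W3" "card W3 = 3" "W3 \<subseteq> verts G" "u1 \<notin> W"
    "\<forall>x\<in>W3. adj G u1 x" and zf3: "zero_forcing_set (complement G) (verts G - W3)"
    by metis
  have "card W3 = Suc 2" using 1 by simp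
  from zero_forcing_complement_stepE[OF zf3 1(3) this]
  obtain u2 w2 W2 where 2: "W3 = insert w2 W2" "w2 \<notin> W2" "card W2 = 2" "W2 \<subseteq> verts G"
    "u2 \<notin> W3" "\<not> adj G u2 w2" "\<forall>x\<in>W2. adj G u2 x"
    and zf2: "zero_forcing_set (complement G) (verts G - W2)"
    by metis
  have "card W2 = Suc 1" using 2 by simp
  from zero_forcing_complement_stepE[OF zf2 2(4) this]
  obtain u3 w3 W1 where 3: "W2 = insert w3 W1" "w3 \<notin> W1" "card W1 = 1"
    "u3 \<notin> W2" "\<not> adj G u3 w3" "\<forall>x\<in>W1. adj G u3 x"
    by metis
  obtain w4 where W1: "W1 = {w4}" using 3(3) by (auto simp: card_1_singleton_iff)
  \<comment> \<open>A forcing vertex is not adjacent to the vertex it forces, whereas all earlier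
    forcing vertices are; hence the three differ.\<close>
  have "u1 \<noteq> u2" "u3 \<noteq> u1" "u3 \<noteq> u2" using 1 2 3 by auto
  then have c: "four_cycle G u1 w4 u2 w3"
    using 1 2 3 W1 by (auto simp: four_cycle_def adj_commute)
  have "degree G u1 \<noteq> 2"
    by (rule degree_neq_2_if_three_neighbors[OF simple, of _ w2 w3 w4])
      (use 1 2 3 W1 in auto)
  moreover have "degree G w4 \<noteq> 2"
    by (rule degree_neq_2_if_three_neighbors[OF simple, of _ u1 u2 u3])
      (use 1 2 3 W1 \<open>u1 \<noteq> u2\<close> \<open>u3 \<noteq> u1\<close> \<open>u3 \<noteq> u2\<close> in \<open>auto simp: adj_commute[of G w4]\<close>)
  ultimately show thesis using that c by blast
qed

text \<open>The starting point of the backward constructions below.\<close>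

lemma zero_forcing_empty_white: "zero_forcing_set (complement G) (verts G - {})"
  by (simp add: zero_forcing_set_def)

text \<open>A common neighbour \<open>x\<close> of the opposite vertices \<open>a\<close> and
  \<open>c\<close> would replace \<open>d\<close> in a second 4-cycle. As \<open>x\<close> is not
  adjacent to \<open>c\<close>, it can later be forced by \<open>c\<close>.\<close>

lemma extra_neighbor:
  assumes "four_cycle G a b c d" "degree G a \<noteq> 2"
  obtains x where "adj G a x" "x \<notin> {a, b, c, d}" "\<not> adj G c x"
proof -
  note cyc = assms(1)[unfolded four_cycle_def]
  have "\<not> adj G a c" using diagonal_not_adj assms(1) by blast
  obtain x where x: "adj G a x" "x \<noteq> b" "x \<noteq> d"
    using third_neighborE[OF simple assms(2), of b d] cyc adj_commute[of G] by auto
  have x': "x \<notin> {a, b, c, d}"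
    using x \<open>\<not> adj G a c\<close> adj_imp_verts[OF simple x(1)] by auto
  have "\<not> adj G c x"
  proof
    assume "adj G c x"
    then have "four_cycle G a b c x"
      using x x' cyc by (auto simp: four_cycle_def adj_commute)
    then have "{a, b, c, x} = {a, b, c, d}" using unique assms(1) by metis
    then show False using x' by auto
  qed
  then show thesis using that x x' by blast
qed

lemma zero_forcing_number_adj_big:
  assumes "four_cycle G a b c d" "degree G a \<noteq> 2" "degree G b \<noteq> 2"
  shows "zero_forcing_number (complement G) = card (verts G) - 4"
proof -
  note cyc = assms(1)[unfolded four_cycle_def]
  note diag = diagonal_not_adj[OF assms(1)] diagonal_not_adj[OF four_cycle_rotate[OF assms(1)]]
  have V: "a \<in> verts G" "b \<in> verts G" "c \<in> verts G" "d \<in> verts G"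
    using cyc adj_imp_verts[OF simple] by blast+
  obtain x where x: "adj G a x" "x \<notin> {a, b, c, d}" "\<not> adj G c x"
    using extra_neighbor[OF assms(1,2)] .
  obtain y where y: "adj G b y" "y \<notin> {b, c, d, a}" "\<not> adj G d y"
    using extra_neighbor[OF four_cycle_rotate[OF assms(1)] assms(3)] .
  have xyV: "x \<in> verts G" "y \<in> verts G" using x y adj_imp_verts[OF simple] by blast+
  \<comment> \<open>In order of time: \<open>a\<close> forces \<open>c\<close>, \<open>c\<close>
    forces \<open>x\<close>, \<open>y\<close> forces \<open>d\<close>, and \<open>d\<close> forces
    \<open>b\<close>. The derivation runs through these in reverse; \<open>c\<close> and
    \<open>d\<close> act only after having been forced.\<close>
  have "zero_forcing_set (complement G) (verts G - {b})"
    by (rule zero_forcing_complement_step[OF zero_forcing_empty_white, where u = d])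
      (use cyc diag V in \<open>auto simp: adj_commute\<close>)
  then have "zero_forcing_set (complement G) (verts G - {d, b})"
    by (rule zero_forcing_complement_step[where u = y])
      (use cyc diag V xyV y in \<open>auto simp: adj_commute\<close>)
  then have "zero_forcing_set (complement G) (verts G - {x, d, b})"
    by (rule zero_forcing_complement_step[where u = c])
      (use cyc diag V xyV x in \<open>auto simp: adj_commute\<close>)
  then have zf: "zero_forcing_set (complement G) (verts G - {c, x, d, b})"
    by (rule zero_forcing_complement_step[where u = a])
      (use cyc diag V xyV x in \<open>auto simp: adj_commute\<close>)
  have "card {c, x, d, b} = 4" using cyc x by auto
  then show ?thesis
    using zero_forcing_number_complement_eqI[of G "{c, x, d, b}" 4] zf no_zero_forcing_5_white
      V xyV simple by (auto simp: simple_graph_def)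
qed

lemma zero_forcing_number_no_adj_big:
  assumes "four_cycle G a b c d" "degree G a \<noteq> 2"
    and "\<And>a b c d. four_cycle G a b c d \<Longrightarrow> degree G a = 2 \<or> degree G b = 2"
  shows "zero_forcing_number (complement G) = card (verts G) - 3"
proof -
  note cyc = assms(1)[unfolded four_cycle_def]
  note diag = diagonal_not_adj[OF assms(1)] diagonal_not_adj[OF four_cycle_rotate[OF assms(1)]]
  have V: "a \<in> verts G" "b \<in> verts G" "c \<in> verts G" "d \<in> verts G"
    using cyc adj_imp_verts[OF simple] by blast+
  obtain x where x: "adj G a x" "x \<notin> {a, b, c, d}" "\<not> adj G c x"
    using extra_neighbor[OF assms(1,2)] .
  have xV: "x \<in> verts G" using x adj_imp_verts[OF simple] by blast
  \<comment> \<open>In order of time: \<open>a\<close> forces \<open>c\<close>, \<open>c\<close>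
    forces \<open>x\<close>, and \<open>b\<close> forces \<open>d\<close>.\<close>
  have "zero_forcing_set (complement G) (verts G - {d})"
    by (rule zero_forcing_complement_step[OF zero_forcing_empty_white, where u = b])
      (use cyc diag V in \<open>auto simp: adj_commute\<close>)
  then have "zero_forcing_set (complement G) (verts G - {x, d})"
    by (rule zero_forcing_complement_step[where u = c])
      (use cyc diag V xV x in \<open>auto simp: adj_commute\<close>)
  then have zf: "zero_forcing_set (complement G) (verts G - {c, x, d})"
    by (rule zero_forcing_complement_step[where u = a])
      (use cyc diag V xV x in \<open>auto simp: adj_commute\<close>)
  have "card {c, x, d} = 3" using cyc x by auto
  \<comment> \<open>Four white vertices would yield two consecutive cycle vertices of degree other
    than 2.\<close>
  moreover have "\<not> zero_forcing_set (complement G) (verts G - W)"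
    if "W \<subseteq> verts G" "card W = Suc 3" for W
  proof
    assume "zero_forcing_set (complement G) (verts G - W)"
    moreover have "card W = 4" using that(2) by simp
    ultimately show False
      using zero_forcing_4_white_imp_adj[OF that(1)] assms(3) by metis
  qed
  ultimately show ?thesis
    using zero_forcing_number_complement_eqI[of G "{c, x, d}" 3] zf V xV simple
    by (auto simp: simple_graph_def)
qed

end

section \<open>Case distinction by the set of degree-2 cycle vertices\<close>

theorem theorem3p9:
  fixes G :: "'a graph" and S :: "'a set" and n :: nat
  assumes "simple_graph G"
    and "unicyclic G"
    and "n = card (verts G)"
    and "n \<ge> 5"
    and "S \<subseteq> verts G"
    and "cycle_graph 4 (induced_subgraph G S)"
  shows "(card {v \<in> S. degree G v = 2} \<le> 1 \<longrightarrow>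
            zero_forcing_number (complement G) = n - 4)
       \<and> (\<forall>u v. u \<noteq> v \<and> {w \<in> S. degree G w = 2} = {u, v} \<longrightarrow>
            (adj G u v \<longrightarrow> zero_forcing_number (complement G) = n - 4) \<and>
            (\<not> adj G u v \<longrightarrow> zero_forcing_number (complement G) = n - 3))
       \<and> (card {v \<in> S. degree G v = 2} = 3 \<longrightarrow>
            zero_forcing_number (complement G) = n - 3)"
proof -
  obtain a b c d where dist: "distinct [a, b, c, d]"
    and C: "induced_subgraph G S = ({a, b, c, d}, {{a, b}, {b, c}, {c, d}, {d, a}})"
    using assms(6) by (auto simp: cycle_graph_4_iff)
  have S: "S = {a, b, c, d}" using C by (simp add: induced_subgraph_def)
  have E: "adj G x y \<longleftrightarrow> {x, y} \<in> {{a, b}, {b, c}, {c, d}, {d, a}}" if "x \<in> S" "y \<in> S" for x y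
  proof -
    have "adj G x y \<longleftrightarrow> {x, y} \<in> edges (induced_subgraph G S)"
      using that by (simp add: induced_subgraph_def adj_def)
    then show ?thesis by (simp add: C)
  qed
  have cyc: "four_cycle G a b c d"
    using dist E by (auto simp: four_cycle_def S)
  interpret unique_four_cycle G S
  proof
    fix p q r s assume c4: "four_cycle G p q r s"
    show pS: "{p, q, r, s} = S" using unicyclic_four_cycle assms c4 by metis
    \<comment> \<open>The graph induced on \<open>S\<close> has only the four cycle edges; a
      diagonal would be a fifth.\<close>
    show "\<not> adj G p r"
    proof
      assume "adj G p r"
      have sub: "p \<in> S" "q \<in> S" "r \<in> S" "s \<in> S" using pS by auto
      show False using c4 \<open>adj G p r\<close> dist sub
        unfolding four_cycle_def E[OF sub(1,2)] E[OF sub(2,3)] E[OF sub(3,4)] E[OF sub(4,1)]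
          E[OF sub(1,3)]
        by (auto simp: S doubleton_eq_iff)
    qed
  qed (rule assms(1))
  define D where "D = {v \<in> S. degree G v = 2}"
  have rot: "four_cycle G b c d a" "four_cycle G c d a b" "four_cycle G d a b c"
    using cyc by (auto simp: four_cycle_def)
  \<comment> \<open>The four alternatives are the four cycle edges: one of them avoids
    \<open>D\<close>.\<close>
  have big: "zero_forcing_number (complement G) = n - 4"
    if "a \<notin> D \<and> b \<notin> D \<or> b \<notin> D \<and> c \<notin> D \<or> c \<notin> D \<and> d \<notin> D \<or> d \<notin> D \<and> a \<notin> D"
    using that zero_forcing_number_adj_big[OF cyc] zero_forcing_number_adj_big[OF rot(1)]
      zero_forcing_number_adj_big[OF rot(2)] zero_forcing_number_adj_big[OF rot(3)] assms(3)
    unfolding D_def S by blast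
  \<comment> \<open>The opposite situation: \<open>D\<close> meets every cycle edge, yet some cycle
    vertex lies outside \<open>D\<close>.\<close>
  have small: "zero_forcing_number (complement G) = n - 3"
    if ne: "D \<noteq> S"
      and hit: "\<And>p q r s. four_cycle G p q r s \<Longrightarrow> p \<in> D \<or> q \<in> D"
  proof -
    have "\<exists>p q r s. four_cycle G p q r s \<and> degree G p \<noteq> 2"
      using ne cyc rot unfolding D_def S by blast
    then show ?thesis
      using zero_forcing_number_no_adj_big hit assms(3) unfolding D_def by blast
  qed
  have "finite D" "D \<subseteq> S" unfolding D_def S by auto
  have cardS: "card S = 4" using dist by (simp add: S)
  \<comment> \<open>If a cycle edge avoids \<open>D\<close>, then \<open>D\<close> lies in the
    opposite edge. This rules out two nonadjacent elements as well as three elements.\<close>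
  have cover: "D \<subseteq> {r, s}" if "four_cycle G p q r s" "p \<notin> D" "q \<notin> D" for p q r s
    using unique[OF that(1)] that(2,3) \<open>D \<subseteq> S\<close> by blast
  have one: "zero_forcing_number (complement G) = n - 4" if "card D \<le> 1"
  proof (rule big, rule ccontr)
    assume "\<not> (a \<notin> D \<and> b \<notin> D \<or> b \<notin> D \<and> c \<notin> D \<or> c \<notin> D \<and> d \<notin> D \<or> d \<notin> D \<and> a \<notin> D)"
    \<comment> \<open>A set meeting all four edges of a 4-cycle contains a pair of opposite
      vertices.\<close>
    then have "{a, c} \<subseteq> D \<or> {b, d} \<subseteq> D" by blast
    moreover have "card {a, c} = 2" "card {b, d} = 2" using dist by auto
    ultimately have "2 \<le> card D" using card_mono[OF \<open>finite D\<close>] by metis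
    then show False using that by simp
  qed
  have two: "(adj G u v \<longrightarrow> zero_forcing_number (complement G) = n - 4) \<and>
      (\<not> adj G u v \<longrightarrow> zero_forcing_number (complement G) = n - 3)"
    if uv: "u \<noteq> v" "D = {u, v}" for u v
  proof (intro conjI impI)
    assume "adj G u v"
    \<comment> \<open>\<open>D\<close> is itself a cycle edge, so the opposite edge avoids
      it.\<close>
    then have "D \<in> {{a, b}, {b, c}, {c, d}, {d, a}}"
      using E[of u v] uv \<open>D \<subseteq> S\<close> by blast
    then show "zero_forcing_number (complement G) = n - 4"
      using dist by (intro big) auto
  next
    assume nadj: "\<not> adj G u v"
    show "zero_forcing_number (complement G) = n - 3"
    proof (rule small)
      show "D \<noteq> S" using uv cardS by auto
      fix p q r s assume c4: "four_cycle G p q r s"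
      show "p \<in> D \<or> q \<in> D"
      proof (rule ccontr)
        assume "\<not> ?thesis"
        then have "{u, v} \<subseteq> {r, s}" using cover[OF c4] uv by blast
        then have "u = r \<and> v = s \<or> u = s \<and> v = r" using uv by blast
        then show False using c4 nadj adj_commute[of G] by (auto simp: four_cycle_def)
      qed
    qed
  qed
  have three: "zero_forcing_number (complement G) = n - 3" if D3: "card D = 3"
  proof (rule small)
    show "D \<noteq> S" using D3 cardS by auto
    fix p q r s assume c4: "four_cycle G p q r s"
    show "p \<in> D \<or> q \<in> D"
    proof (rule ccontr)
      assume "\<not> ?thesis"
      then have "D \<subseteq> {r, s}" using cover[OF c4] by blast
      then have "card D \<le> card {r, s}" by (simp add: card_mono)
      also have "\<dots> \<le> 2" by (simp add: card_insert_if)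
      finally show False using D3 by simp
    qed
  qed
  show ?thesis using one two three unfolding D_def by blast
qed

end
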